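(* Let $\Gamma$ be a discrete group and let $\sigma$ be a $\mathbb{Z}$-valued 2-cocycle on $\Gamma$, with class $[\sigma]\in H^2(\Gamma;\mathbb{Z})$. Let $n\ge1$ and let $Q_n$ be a finite quotient of $\Gamma$ such that $[\sigma]$ is of $n$-$Q_n$ type. Let $\sigma_n$ be a cocycle representative of $[\sigma]$ that is of $n$-$Q_n$ type, and let $\alpha_n\in C^1(\Gamma;\mathbb{Z})$ be a 1-cochain with $\sigma_n+\partial\alpha_n=\sigma$. Put $$\hat\chi_n(g_1,g_2)=\exp\!\left(\tfrac{2\pi i}{n}\big(\alpha_n(g_1)+\sigma_n(g_1,g_2)\big)\right),\qquad g_1,g_2\in\Gamma,$$ and $V_n=\ell^2(Q_n)$, where for $g\in\Gamma$ the image $\bar g\in Q_n$ is regarded as a standard basis element of $V_n$. Then there is a well-defined function $\rho_n:\Gamma\to U(V_n)$ satisfying $$\rho_n(g_1)\bar g_2=\hat\chi_n(g_1,g_2)\,\bar g_1\bar g_2\qquad\text{for all }g_1,g_2\in\Gamma .$$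
   Context: Cochains: $C^k(\Gamma;A)$ is the group of functions $\Gamma^k\to A$ (trivial action on the abelian group $A$), with $\partial\alpha(g,h)=\alpha(h)-\alpha(gh)+\alpha(g)$ for $\alpha\in C^1$, and $\partial\sigma(g_1,g_2,g_3)=\sigma(g_2,g_3)-\sigma(g_1g_2,g_3)+\sigma(g_1,g_2g_3)-\sigma(g_1,g_2)$ for $\sigma\in C^2$; $H^k(\Gamma;A)$ is the resulting cohomology. Let $Q$ be a finite quotient of $\Gamma$ with quotient map $q:\Gamma\to Q$, and let $f^n:\mathbb{Z}\to\mathbb{Z}/n\mathbb{Z}$ be reduction. A cocycle $\sigma\in C^2(\Gamma;\mathbb{Z})$ is of $n$-$Q$ type if there is a cocycle $\sigma'\in C^2(Q;\mathbb{Z}/n\mathbb{Z})$ with $\sigma(g,h)\bmod n=\sigma'(q(g),q(h))$ for all $g,h$. A class $[\sigma]\in H^2(\Gamma;\mathbb{Z})$ is of $n$-$Q$ type if $f^n_*([\sigma])=q^*([\sigma'])$ in $H^2(\Gamma;\mathbb{Z}/n\mathbb{Z})$ for some $[\sigma']\in H^2(Q;\mathbb{Z}/n\mathbb{Z})$. If a class is of $n$-$Q$ type then it has a cocycle representative of $n$-$Q$ type. *)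

theory Defs
  imports "HOL-Algebra.Product_Groups" "HOL-Analysis.Analysis"
begin

text \<open>
  The coefficient group \<open>A\<close> is an abelian group in the sense of HOL-Algebra and hence written
  multiplicatively; it is instantiated to \<open>integer_group\<close> and \<open>integer_mod_group n\<close>.
  Cochains are extensional functions on tuples of elements of the carrier.
\<close>

definition C1 :: "('g, 'm) monoid_scheme \<Rightarrow> ('a, 'k) monoid_scheme \<Rightarrow> ('g \<Rightarrow> 'a) monoid" where
  "C1 G A = product_group (carrier G) (\<lambda>_. A)"

definition C2 :: "('g, 'm) monoid_scheme \<Rightarrow> ('a, 'k) monoid_scheme \<Rightarrow> ('g \<times> 'g \<Rightarrow> 'a) monoid" where
  "C2 G A = product_group (carrier G \<times> carrier G) (\<lambda>_. A)"

definition C3 :: "('g, 'm) monoid_scheme \<Rightarrow> ('a, 'k) monoid_scheme \<Rightarrow> ('g \<times> 'g \<times> 'g \<Rightarrow> 'a) monoid" where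
  "C3 G A = product_group (carrier G \<times> carrier G \<times> carrier G) (\<lambda>_. A)"

definition d1 :: "('g, 'm) monoid_scheme \<Rightarrow> ('a, 'k) monoid_scheme \<Rightarrow> ('g \<Rightarrow> 'a) \<Rightarrow> 'g \<times> 'g \<Rightarrow> 'a" where
  "d1 G A \<alpha> = (\<lambda>(g, h) \<in> carrier G \<times> carrier G.
     \<alpha> h \<otimes>\<^bsub>A\<^esub> inv\<^bsub>A\<^esub> \<alpha> (g \<otimes>\<^bsub>G\<^esub> h) \<otimes>\<^bsub>A\<^esub> \<alpha> g)"

definition d2 :: "('g, 'm) monoid_scheme \<Rightarrow> ('a, 'k) monoid_scheme \<Rightarrow>
    ('g \<times> 'g \<Rightarrow> 'a) \<Rightarrow> 'g \<times> 'g \<times> 'g \<Rightarrow> 'a" where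
  "d2 G A \<sigma> = (\<lambda>(g1, g2, g3) \<in> carrier G \<times> carrier G \<times> carrier G.
     \<sigma> (g2, g3) \<otimes>\<^bsub>A\<^esub> inv\<^bsub>A\<^esub> \<sigma> (g1 \<otimes>\<^bsub>G\<^esub> g2, g3)
       \<otimes>\<^bsub>A\<^esub> \<sigma> (g1, g2 \<otimes>\<^bsub>G\<^esub> g3) \<otimes>\<^bsub>A\<^esub> inv\<^bsub>A\<^esub> \<sigma> (g1, g2))"

definition Z2 :: "('g, 'm) monoid_scheme \<Rightarrow> ('a, 'k) monoid_scheme \<Rightarrow> ('g \<times> 'g \<Rightarrow> 'a) set" where
  "Z2 G A = kernel (C2 G A) (C3 G A) (d2 G A)"

definition B2 :: "('g, 'm) monoid_scheme \<Rightarrow> ('a, 'k) monoid_scheme \<Rightarrow> ('g \<times> 'g \<Rightarrow> 'a) set" where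
  "B2 G A = d1 G A ` carrier (C1 G A)"

definition H2 :: "('g, 'm) monoid_scheme \<Rightarrow> ('a, 'k) monoid_scheme \<Rightarrow> ('g \<times> 'g \<Rightarrow> 'a) set monoid" where
  "H2 G A = (C2 G A)\<lparr>carrier := Z2 G A\<rparr> Mod B2 G A"

definition H2_class :: "('g, 'm) monoid_scheme \<Rightarrow> ('a, 'k) monoid_scheme \<Rightarrow>
    ('g \<times> 'g \<Rightarrow> 'a) \<Rightarrow> ('g \<times> 'g \<Rightarrow> 'a) set" where
  "H2_class G A \<sigma> = B2 G A #>\<^bsub>C2 G A\<^esub> \<sigma>"

definition red2 :: "('g, 'm) monoid_scheme \<Rightarrow> nat \<Rightarrow> ('g \<times> 'g \<Rightarrow> int) \<Rightarrow> 'g \<times> 'g \<Rightarrow> int" where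
  "red2 G n \<sigma> = (\<lambda>x \<in> carrier G \<times> carrier G. \<sigma> x mod int n)"

definition pull2 :: "('g, 'm) monoid_scheme \<Rightarrow> ('g \<Rightarrow> 'q) \<Rightarrow> ('q \<times> 'q \<Rightarrow> 'a) \<Rightarrow> 'g \<times> 'g \<Rightarrow> 'a" where
  "pull2 G q \<sigma>' = (\<lambda>(g, h) \<in> carrier G \<times> carrier G. \<sigma>' (q g, q h))"

text \<open>
  A cohomology class is a coset of cocycles, so an induced map on classes sends \<open>c\<close> to the
  unique class that arises from the members of \<open>c\<close>.
\<close>

definition H2_red :: "('g, 'm) monoid_scheme \<Rightarrow> nat \<Rightarrow> ('g \<times> 'g \<Rightarrow> int) set \<Rightarrow> ('g \<times> 'g \<Rightarrow> int) set" where
  "H2_red G n c = the_elem ((\<lambda>\<sigma>. H2_class G (integer_mod_group n) (red2 G n \<sigma>)) ` c)"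

definition H2_pull :: "('g, 'm) monoid_scheme \<Rightarrow> ('a, 'k) monoid_scheme \<Rightarrow> ('g \<Rightarrow> 'q) \<Rightarrow>
    ('q \<times> 'q \<Rightarrow> 'a) set \<Rightarrow> ('g \<times> 'g \<Rightarrow> 'a) set" where
  "H2_pull G A q c = the_elem ((\<lambda>\<sigma>'. H2_class G A (pull2 G q \<sigma>')) ` c)"

definition cocycle_nQ_type :: "('g, 'm) monoid_scheme \<Rightarrow> ('q, 'k) monoid_scheme \<Rightarrow> ('g \<Rightarrow> 'q) \<Rightarrow>
    nat \<Rightarrow> ('g \<times> 'g \<Rightarrow> int) \<Rightarrow> bool" where
  "cocycle_nQ_type G Q q n \<sigma> \<longleftrightarrow>
     \<sigma> \<in> Z2 G integer_group \<and>
     (\<exists>\<sigma>' \<in> Z2 Q (integer_mod_group n).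
        \<forall>g \<in> carrier G. \<forall>h \<in> carrier G. \<sigma> (g, h) mod int n = \<sigma>' (q g, q h))"

definition class_nQ_type :: "('g, 'm) monoid_scheme \<Rightarrow> ('q, 'k) monoid_scheme \<Rightarrow> ('g \<Rightarrow> 'q) \<Rightarrow>
    nat \<Rightarrow> ('g \<times> 'g \<Rightarrow> int) set \<Rightarrow> bool" where
  "class_nQ_type G Q q n c \<longleftrightarrow>
     c \<in> carrier (H2 G integer_group) \<and>
     (\<exists>c' \<in> carrier (H2 Q (integer_mod_group n)).
        H2_red G n c = H2_pull G (integer_mod_group n) q c')"

text \<open>
  Vectors are functions on the whole type that vanish outside the index set \<open>X\<close>, so that the
  pointwise operations stay inside the space.
\<close>

definition ell2 :: "'q set \<Rightarrow> ('q \<Rightarrow> complex) set" where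
  "ell2 X = {v. (\<forall>x. x \<notin> X \<longrightarrow> v x = 0) \<and> (\<lambda>x. (cmod (v x))\<^sup>2) summable_on X}"

definition ell2_inner :: "'q set \<Rightarrow> ('q \<Rightarrow> complex) \<Rightarrow> ('q \<Rightarrow> complex) \<Rightarrow> complex" where
  "ell2_inner X v w = (\<Sum>\<^sub>\<infinity>x\<in>X. v x * cnj (w x))"

definition ket :: "'q \<Rightarrow> 'q \<Rightarrow> complex" where
  "ket x = indicator {x}"

definition ell2_unitaries :: "'q set \<Rightarrow> (('q \<Rightarrow> complex) \<Rightarrow> 'q \<Rightarrow> complex) set" where
  "ell2_unitaries X = {T \<in> ell2 X \<rightarrow>\<^sub>E ell2 X.
     (\<forall>v \<in> ell2 X. \<forall>w \<in> ell2 X. \<forall>a b.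
        T (\<lambda>x. a * v x + b * w x) = (\<lambda>x. a * T v x + b * T w x)) \<and>
     bij_betw T (ell2 X) (ell2 X) \<and>
     (\<forall>v \<in> ell2 X. \<forall>w \<in> ell2 X. ell2_inner X (T v) (T w) = ell2_inner X v w)}"

definition chi_hat :: "nat \<Rightarrow> ('g \<Rightarrow> int) \<Rightarrow> ('g \<times> 'g \<Rightarrow> int) \<Rightarrow> 'g \<Rightarrow> 'g \<Rightarrow> complex" where
  "chi_hat n \<alpha> \<sigma> g1 g2 = exp (2 * of_real pi * \<i> / of_nat n * of_int (\<alpha> g1 + \<sigma> (g1, g2)))"

end

theory Submission
  imports Defs
begin

text \<open>
  Modulo \<open>n\<close> the integer \<open>\<sigma>\<^sub>n (g1, g2)\<close> depends on \<open>g2\<close> only through its image in \<open>Q\<close>, hence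
  so does the phase \<open>chi_hat n \<alpha>\<^sub>n \<sigma>\<^sub>n g1 g2\<close>. The prescription on the basis is thus that of a
  weighted permutation with unimodular weights, which extends uniquely to a unitary operator.
\<close>

lemma ell2_finite:
  assumes "finite X"
  shows "ell2 X = {v. \<forall>x. x \<notin> X \<longrightarrow> v x = 0}"
  using assms by (auto simp: ell2_def)

lemma ket_in_ell2:
  assumes "finite X" "x \<in> X"
  shows "ket x \<in> ell2 X"
  using assms by (auto simp: ell2_finite ket_def indicator_def)

lemma ell2_unitaries_linear:
  assumes "T \<in> ell2_unitaries X" "v \<in> ell2 X" "w \<in> ell2 X"
  shows "T (\<lambda>x. a * v x + b * w x) = (\<lambda>x. a * T v x + b * T w x)"
  using assms unfolding ell2_unitaries_def by blast

text \<open>For finite \<open>X\<close> the vectors \<open>ket x\<close> span \<open>ell2 X\<close>,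
  so a linear operator is determined by its values on them. This gives the uniqueness half of the
  theorem.\<close>

lemma ell2_unitaries_eqI:
  assumes X: "finite X" and T: "T \<in> ell2_unitaries X" and S: "S \<in> ell2_unitaries X"
    and eq: "\<And>x. x \<in> X \<Longrightarrow> T (ket x) = S (ket x)"
  shows "T = S"
proof -
  \<comment> \<open>The space \<open>ell2 X\<close> stays fixed; the induction is on a finite set
    \<open>F\<close> that contains the support of \<open>v\<close>.\<close>
  have "T v = S v" if "finite F" "F \<subseteq> X" "\<And>x. x \<notin> F \<Longrightarrow> v x = 0" for F v
    using that
  proof (induction F arbitrary: v rule: finite_induct)
    case empty
    then have v: "v = (\<lambda>x. 0)" and "v \<in> ell2 X"
      by (auto simp: ell2_finite X)
    then show ?case
      \<comment> \<open>Linearity with both scalars 0 forces the zero vector to be sent to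
        zero.\<close>
      using ell2_unitaries_linear[OF T, of v v 0 0] ell2_unitaries_linear[OF S, of v v 0 0]
      by simp
  next
    case (insert y F)
    let ?w = "v(y := 0)"
    \<comment> \<open>The coordinate at \<open>y\<close> is split off; the factor 1 gives the shape
      required by \<open>ell2_unitaries_linear\<close>.\<close>
    have v: "v = (\<lambda>x. 1 * ?w x + v y * ket y x)"
      by (auto simp: ket_def fun_eq_iff)
    have w: "?w \<in> ell2 X" using insert.prems by (auto simp: ell2_finite X)
    have k: "ket y \<in> ell2 X" using insert.prems X by (simp add: ket_in_ell2)
    have "T ?w = S ?w" using insert.prems by (intro insert.IH) auto
    moreover have "T (ket y) = S (ket y)" using insert.prems by (simp add: eq)
    moreover have "T v = (\<lambda>x. 1 * T ?w x + v y * T (ket y) x)"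
      by (subst v) (rule ell2_unitaries_linear[OF T w k])
    moreover have "S v = (\<lambda>x. 1 * S ?w x + v y * S (ket y) x)"
      by (subst v) (rule ell2_unitaries_linear[OF S w k])
    ultimately show ?case by simp
  qed
  from this[OF X] have "T v = S v" if "v \<in> ell2 X" for v
    using that by (auto simp: ell2_finite X)
  \<comment> \<open>Off \<open>ell2 X\<close> both operators take the default value
    \<open>undefined\<close>, so agreement on \<open>ell2 X\<close> suffices.\<close>
  moreover have "T \<in> extensional (ell2 X)" "S \<in> extensional (ell2 X)"
    using T S by (auto simp: ell2_unitaries_def PiE_def)
  ultimately show ?thesis by (meson extensionalityI)
qed

text \<open>For a permutation \<open>\<pi>\<close> of a finite \<open>X\<close>, this is the
  operator sending \<open>ket x\<close> to \<open>c x\<close> times \<open>ket (\<pi> x)\<close>. In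
  coordinates, the entry at \<open>y\<close> comes from the preimage of \<open>y\<close>, hence
  \<open>inv_into\<close>.\<close>

definition weighted_perm :: "'q set \<Rightarrow> ('q \<Rightarrow> 'q) \<Rightarrow> ('q \<Rightarrow> complex) \<Rightarrow> ('q \<Rightarrow> complex) \<Rightarrow> 'q \<Rightarrow> complex" where
  "weighted_perm X \<pi> c = (\<lambda>v\<in>ell2 X. \<lambda>y.
     if y \<in> X then c (inv_into X \<pi> y) * v (inv_into X \<pi> y) else 0)"

lemma weighted_perm_apply:
  assumes "bij_betw \<pi> X X" "v \<in> ell2 X" "x \<in> X"
  shows "weighted_perm X \<pi> c v (\<pi> x) = c x * v x"
  using assms by (auto simp: weighted_perm_def bij_betw_inv_into_left bij_betwE)

lemma weighted_perm_ket:
  assumes "finite X" "bij_betw \<pi> X X" "x \<in> X"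
  shows "weighted_perm X \<pi> c (ket x) = (\<lambda>y. c x * ket (\<pi> x) y)"
proof
  fix y
  have px: "\<pi> x \<in> X" using assms by (auto simp: bij_betw_def)
  show "weighted_perm X \<pi> c (ket x) y = c x * ket (\<pi> x) y"
  proof (cases "y \<in> X")
    case True
    then obtain z where z: "z \<in> X" "y = \<pi> z" using assms by (auto simp: bij_betw_def)
    then have eq: "\<pi> z = \<pi> x \<longleftrightarrow> z = x" using assms by (auto simp: bij_betw_def inj_on_def)
    have "weighted_perm X \<pi> c (ket x) y = c z * ket x z"
      using assms z by (simp add: weighted_perm_apply ket_in_ell2)
    also have "\<dots> = c x * ket (\<pi> x) y"
      using eq z by (simp add: ket_def indicator_def)
    finally show ?thesis .
  next
    case False
    then have "y \<noteq> \<pi> x" using px by auto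
    then show ?thesis
      \<comment> \<open>\<open>ket\<close> stays folded in the first call, so that
        \<open>ket_in_ell2\<close> can discharge the domain restriction.\<close>
      using False assms by (simp add: weighted_perm_def ket_in_ell2) (simp add: ket_def)
  qed
qed

text \<open>Permuting coordinates only reorders the sum in the inner product, and each weight
  cancels against its conjugate. Weights of modulus 1 are also nonzero, so the operator can be
  inverted by dividing.\<close>

lemma weighted_perm_unitary:
  assumes X: "finite X" and \<pi>: "bij_betw \<pi> X X" and c: "\<And>x. x \<in> X \<Longrightarrow> cmod (c x) = 1"
  shows "weighted_perm X \<pi> c \<in> ell2_unitaries X"
proof -
  let ?T = "weighted_perm X \<pi> c"
  have closed: "?T v \<in> ell2 X" if "v \<in> ell2 X" for v
    using that X by (auto simp: weighted_perm_def ell2_finite)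
  have c0: "c x \<noteq> 0" if "x \<in> X" for x
    using c[OF that] by auto
  have linear: "?T (\<lambda>x. a * v x + b * w x) = (\<lambda>x. a * ?T v x + b * ?T w x)"
    if "v \<in> ell2 X" "w \<in> ell2 X" for v w a b
  proof -
    have "(\<lambda>x. a * v x + b * w x) \<in> ell2 X"
      using that X by (auto simp: ell2_finite)
    then show ?thesis
      using that by (auto simp: weighted_perm_def algebra_simps)
  qed
  have inj: "inj_on ?T (ell2 X)"
  proof (rule inj_onI, rule ext)
    fix v w x assume v: "v \<in> ell2 X" and w: "w \<in> ell2 X" and eq: "?T v = ?T w"
    show "v x = w x"
    proof (cases "x \<in> X")
      case True
      then have "c x * v x = c x * w x"
        using eq weighted_perm_apply[OF \<pi>] v w by metis
      then show ?thesis using c0[OF True] by simp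
    next
      case False
      then show ?thesis using v w X by (auto simp: ell2_finite)
    qed
  qed
  have surj: "w \<in> ?T ` ell2 X" if w: "w \<in> ell2 X" for w
  proof
    \<comment> \<open>The preimage of \<open>w\<close>: undo the permutation, then divide by the
      weight.\<close>
    let ?v = "\<lambda>x. if x \<in> X then w (\<pi> x) / c x else 0"
    show v: "?v \<in> ell2 X" using X by (auto simp: ell2_finite)
    show "w = ?T ?v"
    proof
      fix y
      show "w y = ?T ?v y"
      proof (cases "y \<in> X")
        case True
        then obtain x where "x \<in> X" "y = \<pi> x" using \<pi> by (auto simp: bij_betw_def)
        then show ?thesis using weighted_perm_apply[OF \<pi> v] c0 by simp
      next
        case False
        then show ?thesis using closed[OF v] w X by (simp add: ell2_finite)
      qed
    qed
  qed
  have inner: "ell2_inner X (?T v) (?T w) = ell2_inner X v w"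
    if v: "v \<in> ell2 X" and w: "w \<in> ell2 X" for v w
  proof -
    have unimodular: "c x * cnj (c x) = 1" if "x \<in> X" for x
      using c[OF that] complex_norm_square[of "c x"] by simp
    \<comment> \<open>Summing over \<open>\<pi> x\<close> instead of \<open>y\<close> makes
      \<open>weighted_perm_apply\<close> available and removes the inverse of
      \<open>\<pi>\<close>.\<close>
    have "(\<Sum>y\<in>X. ?T v y * cnj (?T w y)) = (\<Sum>x\<in>X. ?T v (\<pi> x) * cnj (?T w (\<pi> x)))"
      by (rule sum.reindex_bij_betw[OF \<pi>, symmetric])
    also have "\<dots> = (\<Sum>x\<in>X. (c x * cnj (c x)) * (v x * cnj (w x)))"
      by (intro sum.cong refl) (simp add: weighted_perm_apply[OF \<pi>] v w mult_ac)
    also have "\<dots> = (\<Sum>x\<in>X. v x * cnj (w x))"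
      by (simp add: unimodular)
    finally show ?thesis using X by (simp add: ell2_inner_def)
  qed
  have "?T \<in> ell2 X \<rightarrow>\<^sub>E ell2 X"
    using closed by (auto simp: weighted_perm_def)
  moreover have "bij_betw ?T (ell2 X) (ell2 X)"
    using inj surj closed by (auto simp: bij_betw_def)
  ultimately show ?thesis
    using linear inner by (auto simp: ell2_unitaries_def)
qed

text \<open>Shifting the integer by \<open>int n * k\<close> shifts the exponent by \<open>k\<close>
  full periods of \<open>exp\<close>.\<close>

lemma exp_2pi_over_n_cong:
  assumes "n \<ge> 1" "a mod int n = b mod int n"
  shows "exp (2 * of_real pi * \<i> / of_nat n * of_int a) = exp (2 * of_real pi * \<i> / of_nat n * of_int b)"
proof -
  obtain k where "a = b + int n * k"
    using assms(2) by (metis mod_eqE)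
  then have "2 * of_real pi * \<i> / of_nat n * of_int a
      = 2 * of_real pi * \<i> / of_nat n * of_int b + of_int (2 * k) * of_real pi * \<i>"
    using assms(1) by (simp add: field_simps)
  then show ?thesis
    by (auto simp: exp_eq)
qed

lemma cmod_chi_hat: "cmod (chi_hat n \<alpha> \<sigma> g1 g2) = 1"
  by (simp add: chi_hat_def)

text \<open>Here the type condition enters: modulo \<open>n\<close> the cocycle factors through
  \<open>q\<close>, while the \<open>\<alpha>\<close> term involves only the first argument. Hence
  the phase is independent of the lift chosen for an element of \<open>Q\<close>.\<close>

lemma chi_hat_cong:
  assumes "cocycle_nQ_type G Q q n \<sigma>" "n \<ge> 1"
    and "g \<in> carrier G" "h \<in> carrier G" "h' \<in> carrier G" "q h = q h'"
  shows "chi_hat n \<alpha> \<sigma> g h = chi_hat n \<alpha> \<sigma> g h'"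
proof -
  have "\<sigma> (g, h) mod int n = \<sigma> (g, h') mod int n"
    using assms unfolding cocycle_nQ_type_def by metis
  then have "(\<alpha> g + \<sigma> (g, h)) mod int n = (\<alpha> g + \<sigma> (g, h')) mod int n"
    by (intro mod_add_cong refl)
  then show ?thesis
    unfolding chi_hat_def by (rule exp_2pi_over_n_cong[OF assms(2)])
qed

theorem proposition3p17:
  fixes \<Gamma> :: "('g, 'm) monoid_scheme" and Q :: "('q, 'k) monoid_scheme" and q :: "'g \<Rightarrow> 'q"
    and n :: nat and \<sigma> \<sigma>\<^sub>n :: "'g \<times> 'g \<Rightarrow> int" and \<alpha>\<^sub>n :: "'g \<Rightarrow> int"
  assumes "group \<Gamma>"
    and "\<sigma> \<in> Z2 \<Gamma> integer_group"
    and "n \<ge> 1"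
    and "group Q" and "finite (carrier Q)" and "q \<in> epi \<Gamma> Q"
    and "class_nQ_type \<Gamma> Q q n (H2_class \<Gamma> integer_group \<sigma>)"
    and "cocycle_nQ_type \<Gamma> Q q n \<sigma>\<^sub>n"
    and "H2_class \<Gamma> integer_group \<sigma>\<^sub>n = H2_class \<Gamma> integer_group \<sigma>"
    and "\<alpha>\<^sub>n \<in> carrier (C1 \<Gamma> integer_group)"
    and "\<sigma>\<^sub>n \<otimes>\<^bsub>C2 \<Gamma> integer_group\<^esub> d1 \<Gamma> integer_group \<alpha>\<^sub>n = \<sigma>"
  shows "\<exists>!\<rho>. \<rho> \<in> carrier \<Gamma> \<rightarrow>\<^sub>E ell2_unitaries (carrier Q) \<and>
    (\<forall>g1 \<in> carrier \<Gamma>. \<forall>g2 \<in> carrier \<Gamma>.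
       \<rho> g1 (ket (q g2)) = (\<lambda>x. chi_hat n \<alpha>\<^sub>n \<sigma>\<^sub>n g1 g2 * ket (q g1 \<otimes>\<^bsub>Q\<^esub> q g2) x))"
proof -
  interpret Q: group Q by fact
  let ?X = "carrier Q"
  \<comment> \<open>The weight at \<open>x\<close> is computed from an arbitrary lift of
    \<open>x\<close> to \<open>\<Gamma>\<close>.\<close>
  let ?c = "\<lambda>g x. chi_hat n \<alpha>\<^sub>n \<sigma>\<^sub>n g (inv_into (carrier \<Gamma>) q x)"
  let ?\<rho> = "\<lambda>g\<in>carrier \<Gamma>. weighted_perm ?X (\<lambda>x. q g \<otimes>\<^bsub>Q\<^esub> x) (?c g)"
  note X = \<open>finite (carrier Q)\<close>
  have q: "q ` carrier \<Gamma> = ?X"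
    using \<open>q \<in> epi \<Gamma> Q\<close> by (auto simp: epi_def)
  \<comment> \<open>Left translation by \<open>q g\<close> permutes the group
    \<open>Q\<close>.\<close>
  have bij: "bij_betw (\<lambda>x. q g \<otimes>\<^bsub>Q\<^esub> x) ?X ?X" if "g \<in> carrier \<Gamma>" for g
  proof -
    have "q g \<in> ?X" using q that by blast
    then show ?thesis
      by (auto simp: bij_betw_def Q.inj_on_multc Q.inj_on_cmult Q.surj_const_mult)
  qed
  show ?thesis
  proof (rule ex1I[of _ ?\<rho>], intro conjI ballI)
    show "?\<rho> \<in> carrier \<Gamma> \<rightarrow>\<^sub>E ell2_unitaries ?X"
      using X bij by (auto intro!: weighted_perm_unitary simp: cmod_chi_hat)
    fix g1 g2 assume g: "g1 \<in> carrier \<Gamma>" "g2 \<in> carrier \<Gamma>"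
    then have "q g2 \<in> ?X" using q by blast
    \<comment> \<open>The chosen lift of \<open>q g2\<close> may differ from \<open>g2\<close>, but
      has the same image in \<open>Q\<close>; this is the well-definedness of
      \<open>\<rho>\<close>.\<close>
    moreover have "?c g1 (q g2) = chi_hat n \<alpha>\<^sub>n \<sigma>\<^sub>n g1 g2"
      by (rule chi_hat_cong[OF \<open>cocycle_nQ_type \<Gamma> Q q n \<sigma>\<^sub>n\<close> \<open>n \<ge> 1\<close>])
        (use g in \<open>auto simp: inv_into_into f_inv_into_f\<close>)
    ultimately show "?\<rho> g1 (ket (q g2)) =
        (\<lambda>x. chi_hat n \<alpha>\<^sub>n \<sigma>\<^sub>n g1 g2 * ket (q g1 \<otimes>\<^bsub>Q\<^esub> q g2) x)"
      using g X by (simp add: weighted_perm_ket bij)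
  next
    fix \<rho>
    assume \<rho>: "\<rho> \<in> carrier \<Gamma> \<rightarrow>\<^sub>E ell2_unitaries ?X \<and>
      (\<forall>g1\<in>carrier \<Gamma>. \<forall>g2\<in>carrier \<Gamma>.
        \<rho> g1 (ket (q g2)) = (\<lambda>x. chi_hat n \<alpha>\<^sub>n \<sigma>\<^sub>n g1 g2 * ket (q g1 \<otimes>\<^bsub>Q\<^esub> q g2) x))"
    show "\<rho> = ?\<rho>"
    proof (rule extensionalityI)
      show "\<rho> \<in> extensional (carrier \<Gamma>)" using \<rho> by (auto simp: PiE_def)
      show "?\<rho> \<in> extensional (carrier \<Gamma>)" by simp
      fix g assume g: "g \<in> carrier \<Gamma>"
      have "\<rho> g = weighted_perm ?X (\<lambda>x. q g \<otimes>\<^bsub>Q\<^esub> x) (?c g)"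
      proof (rule ell2_unitaries_eqI[OF X])
        show "\<rho> g \<in> ell2_unitaries ?X" using \<rho> g by auto
        show "weighted_perm ?X (\<lambda>x. q g \<otimes>\<^bsub>Q\<^esub> x) (?c g) \<in> ell2_unitaries ?X"
          using X bij[OF g] by (auto intro!: weighted_perm_unitary simp: cmod_chi_hat)
        fix x assume x: "x \<in> ?X"
        \<comment> \<open>By surjectivity of \<open>q\<close> every basis vector has the form
          \<open>ket (q ?h)\<close>, so the prescription fixes \<open>\<rho> g\<close> on the whole
          basis.\<close>
        let ?h = "inv_into (carrier \<Gamma>) q x"
        have "?h \<in> carrier \<Gamma>" "q ?h = x"
          using x q by (auto simp: inv_into_into f_inv_into_f)
        then have "\<rho> g (ket x) = (\<lambda>y. ?c g x * ket (q g \<otimes>\<^bsub>Q\<^esub> x) y)"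
          using conjunct2[OF \<rho>, rule_format, OF g, of ?h] by simp
        then show "\<rho> g (ket x) = weighted_perm ?X (\<lambda>x. q g \<otimes>\<^bsub>Q\<^esub> x) (?c g) (ket x)"
          using weighted_perm_ket[OF X bij[OF g] x] by simp
      qed
      then show "\<rho> g = ?\<rho> g" using g by simp
    qed
  qed
qed

end
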